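(* Let $f$ be analytic in the open unit disk $\mathbb{D}$ with $|f(z)|<1$ for all $z\in\mathbb{D}$, and let $f(z)=\sum_{j=0}^\infty a_j z^j$ be its power series expansion. Then for every integer $n\ge 0$, $$\left|\sum_{k=0}^n\frac{f^{(k)}(z)}{k!}z^k\right|\le \sum_{k=0}^n \binom{-\frac12}{k}^2 \quad\text{for all } z \text{ with } |z|\le \tfrac12 .$$
   Context: $\mathbb{D}=\{z\in\mathbb{C}: |z|<1\}$. $f^{(k)}$ is the $k$-th complex derivative, $f^{(0)}=f$. The generalized binomial coefficient is $\binom{-1/2}{k}=\frac{(-\frac12)(-\frac12-1)\cdots(-\frac12-k+1)}{k!}$, with $\binom{-1/2}{0}=1$. *)

theory Defs
  imports "HOL-Complex_Analysis.Complex_Analysis"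
begin

end

theory Submission
  imports Defs
begin

text \<open>For \<open>norm z \<le> 1 / 2\<close> the map \<open>w \<mapsto> z * w + z\<close> sends the unit disk into itself, and the sum in
  question is the sum of the first \<open>n + 1\<close> Taylor coefficients at \<open>0\<close> of \<open>g w = f (z * w + z)\<close>. It is
  therefore bounded by the Landau constant. For Landau's inequality, let \<open>K\<close> be the \<open>n\<close>-th partial sum
  of the binomial series of \<open>(1 - w) powr (- 1 / 2)\<close>. As the square of that series is \<open>1 / (1 - w)\<close>, the
  sum is the \<open>n\<close>-th Taylor coefficient of \<open>g w * (K w)\<^sup>2\<close>. Cauchy's formula on a circle of radius \<open>r < 1\<close>
  bounds it by the mean of \<open>(norm (K w))\<^sup>2 / r ^ n\<close>, which Parseval's identity evaluates; then let \<open>r\<close>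
  tend to \<open>1\<close>.\<close>

text \<open>Coefficientwise form of the identity that the square of (1 - w) powr (- 1 / 2) is 1 / (1
  - w). The alternating signs factor out of the convolution as \<open>(-1) ^ m\<close>, and
  Vandermonde reduces the rest to exponent -1.\<close>

lemma gbinomial_half_convolution:
  defines "c \<equiv> \<lambda>k. (-1) ^ k * ((- 1 / 2 :: 'a :: field_char_0) gchoose k)"
  shows "(\<Sum>i=0..m. c i * c (m - i)) = 1"
proof -
  have "(\<Sum>i=0..m. c i * c (m - i)) =
      (-1) ^ m * (\<Sum>i=0..m. ((- 1 / 2 :: 'a) gchoose i) * ((- 1 / 2) gchoose (m - i)))"
    unfolding sum_distrib_left
  proof (rule sum.cong)
    fix i assume "i \<in> {0..m}"
    then have "(-1 :: 'a) ^ m = (-1) ^ i * (-1) ^ (m - i)"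
      by (simp flip: power_add)
    then show "c i * c (m - i) =
        (-1) ^ m * (((- 1 / 2) gchoose i) * ((- 1 / 2) gchoose (m - i)))"
      by (simp add: c_def)
  qed simp
  also have "(\<Sum>i=0..m. ((- 1 / 2 :: 'a) gchoose i) * ((- 1 / 2) gchoose (m - i))) =
      (- 1 / 2 + - 1 / 2) gchoose m"
    by (rule gbinomial_Vandermonde)
  also have "(- 1 / 2 + - 1 / 2 :: 'a) = - 1"
    by simp
  also have "(- 1 :: 'a) gchoose m = (-1) ^ m"
    \<comment> \<open>Negating the upper index 1 turns it into 1 + m - 1 = m, and m choose m is
      1.\<close>
    using gbinomial_minus[of "1 :: 'a" m] by (simp flip: binomial_gbinomial)
  finally show ?thesis
    by (simp flip: power_mult_distrib)
qed

lemma has_integral_cos_frequency: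
  fixes m :: int
  shows "((\<lambda>t. cos (2 * pi * of_int m * t)) has_integral (if m = 0 then 1 else 0)) {0..1}"
proof (cases "m = 0")
  case True
  then show ?thesis
    using has_integral_const_real[of "1 :: real" 0 1] by simp
next
  case False
  let ?F = "\<lambda>t. sin (2 * pi * of_int m * t) / (2 * pi * of_int m)"
  have "((\<lambda>t. cos (2 * pi * of_int m * t)) has_integral (?F 1 - ?F 0)) {0..1}"
    using False
    by (intro fundamental_theorem_of_calculus)
       (auto intro!: derivative_eq_intros simp flip: has_real_derivative_iff_has_vector_derivative)
  moreover have "sin (2 * pi * of_int m) = 0"
    using sin_int_2pin[of m] by simp
  ultimately show ?thesis
    using False by simp
qed

text \<open>As the coefficients are real, the squared norm is a double sum of cosines of frequency
  differences; integration over a full period leaves only the diagonal.\<close>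

lemma Parseval_trigonometric_polynomial:
  fixes p :: "nat \<Rightarrow> real"
  assumes "finite A"
  shows "((\<lambda>t. (norm (\<Sum>k\<in>A. complex_of_real (p k) * cis (2 * pi * real k * t)))\<^sup>2)
           has_integral (\<Sum>k\<in>A. (p k)\<^sup>2)) {0..1}"
proof -
  have expand: "(norm (\<Sum>k\<in>A. complex_of_real (p k) * cis (2 * pi * real k * t)))\<^sup>2 =
      (\<Sum>i\<in>A. \<Sum>j\<in>A. p i * p j * cos (2 * pi * of_int (int i - int j) * t))" for t
  proof -
    have "(norm (\<Sum>k\<in>A. complex_of_real (p k) * cis (2 * pi * real k * t)))\<^sup>2 =
        (\<Sum>k\<in>A. p k * cos (2 * pi * real k * t))\<^sup>2 + (\<Sum>k\<in>A. p k * sin (2 * pi * real k * t))\<^sup>2"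
      by (simp add: cmod_power2)
    also have "\<dots> = (\<Sum>i\<in>A. \<Sum>j\<in>A. p i * p j * cos (2 * pi * of_int (int i - int j) * t))"
      by (simp add: power2_eq_square sum_product left_diff_distrib right_diff_distrib cos_diff
            distrib_left mult_ac flip: sum.distrib)
    finally show ?thesis .
  qed
  have "((\<lambda>t. \<Sum>i\<in>A. \<Sum>j\<in>A. p i * p j * cos (2 * pi * of_int (int i - int j) * t))
      has_integral (\<Sum>i\<in>A. \<Sum>j\<in>A. p i * p j * (if int i - int j = 0 then 1 else 0))) {0..1}"
    using assms by (intro has_integral_sum has_integral_mult_right has_integral_cos_frequency)
  also have "(\<Sum>i\<in>A. \<Sum>j\<in>A. p i * p j * (if int i - int j = 0 then 1 else 0)) = (\<Sum>k\<in>A. (p k)\<^sup>2)"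
    using assms by (intro sum.cong) (auto simp: power2_eq_square if_distrib sum.delta' cong: if_cong)
  finally show ?thesis
    by (simp only: expand)
qed

text \<open>The factor multiplying \<open>f\<close> is a square so that its norm on the circle is a
  squared norm, whose mean Parseval computes exactly. The radius stays below 1 because
  \<open>f\<close> is controlled only on the open disk.\<close>

lemma Taylor_coeff_mult_square_bound:
  fixes f :: "complex \<Rightarrow> complex" and c :: "nat \<Rightarrow> real" and n :: nat
  defines "K \<equiv> \<lambda>w. \<Sum>k\<le>n. complex_of_real (c k) * w ^ k"
  assumes holf: "f holomorphic_on ball 0 1"
    and bound: "\<And>w. w \<in> ball 0 1 \<Longrightarrow> norm (f w) \<le> 1"
    and r: "0 < r" "r < 1"
  shows "norm ((deriv ^^ m) (\<lambda>w. f w * (K w)\<^sup>2) 0 / fact m) \<le> (\<Sum>k\<le>n. (c k * r ^ k)\<^sup>2) / r ^ m"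
proof -
  define h where "h = (\<lambda>w. f w * (K w)\<^sup>2)"
  define \<gamma> where "\<gamma> = circlepath 0 r"
  have \<gamma>: "\<gamma> t = complex_of_real r * cis (2 * pi * t)" for t
    by (simp add: \<gamma>_def circlepath cis_conv_exp mult_ac)
  have norm_\<gamma>: "norm (\<gamma> t) = r" for t
    using r by (simp add: \<gamma> norm_mult)
  have holh: "h holomorphic_on ball 0 1"
    unfolding h_def K_def by (intro holomorphic_intros holf)
  have "cball (0 :: complex) r \<subseteq> ball 0 1"
    using r by auto
  then have "continuous_on (cball 0 r) h" "h holomorphic_on ball 0 r"
    using holh r
    by (auto intro: holomorphic_on_imp_continuous_on continuous_on_subset holomorphic_on_subset)
  then have "((\<lambda>u. h u / (u - 0) ^ Suc m) has_contour_integral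
      (2 * pi * \<i>) / fact m * (deriv ^^ m) h 0) \<gamma>"
    unfolding \<gamma>_def using r by (intro Cauchy_has_contour_integral_higher_derivative_circlepath) auto
  then have int: "((\<lambda>t. h (\<gamma> t) / \<gamma> t ^ Suc m * vector_derivative \<gamma> (at t)) has_integral
      (2 * pi * \<i>) / fact m * (deriv ^^ m) h 0) {0..1}"
    by (simp add: has_contour_integral)
  \<comment> \<open>The inner product with 1 is the identity on the reals; it matches the
    componentwise form of the integral comparison used below.\<close>
  have int_bound: "norm (h (\<gamma> t) / \<gamma> t ^ Suc m * vector_derivative \<gamma> (at t)) \<le>
      (2 * pi / r ^ m * (norm (\<Sum>k\<le>n. complex_of_real (c k * r ^ k) * cis (2 * pi * real k * t)))\<^sup>2) \<bullet> 1"
    for t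
  proof -
    have "norm (vector_derivative \<gamma> (at t)) = 2 * pi * r"
      using r by (simp add: \<gamma>_def vector_derivative_circlepath norm_mult)
    \<comment> \<open>The speed contributes a factor \<open>r\<close>, which lowers
      \<open>r ^ Suc m\<close> to \<open>r ^ m\<close>.\<close>
    then have "norm (h (\<gamma> t) / \<gamma> t ^ Suc m * vector_derivative \<gamma> (at t)) = 2 * pi / r ^ m * norm (h (\<gamma> t))"
      using r by (simp add: norm_mult norm_divide norm_power norm_\<gamma>)
    also have "norm (h (\<gamma> t)) \<le> 1 * (norm (K (\<gamma> t)))\<^sup>2"
      using bound[of "\<gamma> t"] r unfolding h_def norm_mult norm_power
      by (intro mult_right_mono) (auto simp: norm_\<gamma>)
    also have "K (\<gamma> t) = (\<Sum>k\<le>n. complex_of_real (c k * r ^ k) * cis (2 * pi * real k * t))"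
      by (simp add: K_def \<gamma> power_mult_distrib Complex.DeMoivre mult_ac)
    finally show ?thesis
      using r by (simp add: mult_left_mono divide_right_mono)
  qed
  have "norm ((2 * pi * \<i>) / fact m * (deriv ^^ m) h 0) \<le> (2 * pi / r ^ m * (\<Sum>k\<le>n. (c k * r ^ k)\<^sup>2)) \<bullet> 1"
    by (rule has_integral_norm_bound_integral_component[OF int _ int_bound])
       (intro has_integral_mult_right Parseval_trigonometric_polynomial finite_atMost)
  then have "2 * pi * norm ((deriv ^^ m) h 0 / fact m) \<le> 2 * pi * ((\<Sum>k\<le>n. (c k * r ^ k)\<^sup>2) / r ^ m)"
    by (simp add: norm_mult norm_divide)
  then show ?thesis
    unfolding h_def by (subst (asm) mult_le_cancel_left_pos) auto
qed

lemma Landau_coefficient_sum_bound: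
  fixes f :: "complex \<Rightarrow> complex"
  assumes holf: "f holomorphic_on ball 0 1"
    and bound: "\<And>w. w \<in> ball 0 1 \<Longrightarrow> norm (f w) \<le> 1"
  shows "norm (\<Sum>k=0..n. (deriv ^^ k) f 0 / fact k) \<le> (\<Sum>k=0..n. ((- 1 / 2 :: real) gchoose k)\<^sup>2)"
proof -
  define c where "c k = (-1) ^ k * ((- 1 / 2 :: real) gchoose k)" for k
  define K where "K w = (\<Sum>k\<le>n. complex_of_real (c k) * w ^ k)" for w
  define F where "F = fps_expansion f 0"
  define P where "P = (\<Sum>k\<le>n. fps_const (complex_of_real (c k)) * fps_X ^ k)"
  have f_exp: "f has_fps_expansion F"
    unfolding F_def using holf by (intro has_fps_expansion_fps_expansion[of "ball 0 1"]) auto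
  have K_exp: "K has_fps_expansion P"
    unfolding K_def P_def by (intro fps_expansion_intros)
  have P_nth: "fps_nth P j = complex_of_real (c j)" if "j \<le> n" for j
    using that by (simp add: P_def fps_sum_nth fps_X_power_iff if_distrib sum.delta' cong: if_cong)
  \<comment> \<open>Truncating the series after degree \<open>n\<close> does not affect the
    coefficients of its square up to \<open>n\<close>, and the \<open>n\<close>-th coefficient of
    \<open>F * P\<^sup>2\<close> involves no others.\<close>
  have P2_nth: "fps_nth (P\<^sup>2) j = 1" if "j \<le> n" for j
  proof -
    have "fps_nth (P\<^sup>2) j = (\<Sum>i=0..j. complex_of_real (c i * c (j - i)))"
      using that by (simp add: power2_eq_square fps_mult_nth P_nth)
    also have "\<dots> = complex_of_real (\<Sum>i=0..j. c i * c (j - i))"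
      by simp
    also have "(\<Sum>i=0..j. c i * c (j - i)) = 1"
      unfolding c_def by (rule gbinomial_half_convolution)
    finally show ?thesis
      by simp
  qed
  have "(\<lambda>w. f w * (K w)\<^sup>2) has_fps_expansion F * P\<^sup>2"
    by (intro fps_expansion_intros f_exp K_exp)
  then have "(deriv ^^ n) (\<lambda>w. f w * (K w)\<^sup>2) 0 / fact n = fps_nth (F * P\<^sup>2) n"
    by (simp add: fps_nth_fps_expansion)
  also have "\<dots> = (\<Sum>k=0..n. (deriv ^^ k) f 0 / fact k)"
    by (simp add: fps_mult_nth P2_nth fps_nth_fps_expansion[OF f_exp])
  finally have coeff:
    "(deriv ^^ n) (\<lambda>w. f w * (K w)\<^sup>2) 0 / fact n = (\<Sum>k=0..n. (deriv ^^ k) f 0 / fact k)" .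
  have "norm (\<Sum>k=0..n. (deriv ^^ k) f 0 / fact k) \<le> (\<Sum>k\<le>n. (c k * r ^ k)\<^sup>2) / r ^ n"
    if "0 < r" "r < 1" for r
    using Taylor_coeff_mult_square_bound[OF holf bound that, of n c n] coeff by (simp add: K_def)
  \<comment> \<open>The left side does not depend on \<open>r\<close>, so the bound survives the
    limit at 1, where the powers of \<open>r\<close> disappear.\<close>
  then have "\<forall>\<^sub>F r in at_left 1.
      norm (\<Sum>k=0..n. (deriv ^^ k) f 0 / fact k) \<le> (\<Sum>k\<le>n. (c k * r ^ k)\<^sup>2) / r ^ n"
    using eventually_at_left_real[of 0 "1 :: real"] by (auto elim: eventually_mono)
  moreover have "((\<lambda>r. (\<Sum>k\<le>n. (c k * r ^ k)\<^sup>2) / r ^ n) \<longlongrightarrow> (\<Sum>k\<le>n. (c k * 1 ^ k)\<^sup>2) / 1 ^ n)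
      (at_left 1)"
    by (intro tendsto_intros) auto
  ultimately have "norm (\<Sum>k=0..n. (deriv ^^ k) f 0 / fact k) \<le> (\<Sum>k\<le>n. (c k * 1 ^ k)\<^sup>2) / 1 ^ n"
    by (intro tendsto_lowerbound) auto
  then show ?thesis
    by (simp add: c_def power_mult_distrib atLeast0AtMost flip: power_mult)
qed

theorem theorem1:
  fixes f :: "complex \<Rightarrow> complex" and a :: "nat \<Rightarrow> complex" and n :: nat and z :: complex
  assumes "f analytic_on ball 0 1"
    and "\<And>w. w \<in> ball 0 1 \<Longrightarrow> norm (f w) < 1"
    and "\<And>w. w \<in> ball 0 1 \<Longrightarrow> (\<lambda>j. a j * w ^ j) sums f w"
    and "norm z \<le> 1 / 2"
  shows "norm (\<Sum>k=0..n. (deriv ^^ k) f z / fact k * z ^ k)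
           \<le> (\<Sum>k=0..n. ((- 1 / 2 :: real) gchoose k)\<^sup>2)"
proof -
  define g where "g w = f (z * w + z)" for w
  \<comment> \<open>For nonzero \<open>z\<close> the norm is strictly below twice
    \<open>norm z\<close>, hence below 1; strictness fails for \<open>z = 0\<close>, where the image
    is just 0.\<close>
  have maps: "z * w + z \<in> ball 0 1" if "w \<in> ball 0 1" for w
  proof (cases "z = 0")
    case False
    have "norm (z * w + z) \<le> norm z * norm w + norm z"
      by (metis norm_mult norm_triangle_ineq)
    also have "norm z * norm w < norm z * 1"
      using that False by (intro mult_strict_left_mono) auto
    finally show ?thesis
      using assms(4) by simp
  qed simp
  have holf: "f holomorphic_on ball 0 1"
    using assms(1) by (rule analytic_imp_holomorphic)
  have "g holomorphic_on ball 0 1"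
    unfolding g_def using maps
    by (intro holomorphic_on_compose_gen[OF _ holf, unfolded o_def] holomorphic_intros) auto
  moreover have "norm (g w) \<le> 1" if "w \<in> ball 0 1" for w
    using assms(2)[OF maps[OF that]] by (simp add: g_def)
  \<comment> \<open>The chain rule for an affine map: each derivative brings out one factor
    \<open>z\<close>, and 0 is mapped to \<open>z\<close>.\<close>
  moreover have "(deriv ^^ k) g 0 = z ^ k * (deriv ^^ k) f z" for k
    unfolding g_def
    using higher_deriv_compose_linear'[OF holf, of "ball 0 1" 0 z z k] maps by simp
  ultimately show ?thesis
    using Landau_coefficient_sum_bound[of g n] by (simp add: mult_ac)
qed

end
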